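(* Let $g=\{g_n\}_{n\ge 1}$ be any strictly positive sequence of real numbers, with the convention $g_0=0$, and let $\lambda=\{\lambda_n\}_{n\ge 1}$ be a sequence of real numbers with $\lambda_n>0$ for all $n\in\mathbb{N}$. For $n\in\mathbb{N}$ define $$w_n(\lambda,g)=\frac{1}{\lambda_n}+\frac{1}{\lambda_{n+1}}-\frac{g_{n-1}}{\lambda_n g_n}-\frac{g_{n+1}}{\lambda_{n+1}g_n}.$$ Then for every sequence $A=(A_n)_{n\ge0}\in C_c(\mathbb{N}_0)$ of real or complex numbers with $A_0=0$, $$\sum_{n=1}^{\infty}w_n(\lambda,g)|A_n|^2\le\sum_{n=1}^{\infty}\frac{|A_n-A_{n-1}|^2}{\lambda_n}.$$ Further, if there exists a sequence of (real-valued) elements $\gamma^N\in C_c(\mathbb{N}_0)$ such that $\gamma^N\le\gamma^{N+1}$ pointwise for all $N$, $\gamma^N\to1$ pointwise as $N\to\infty$, and $$\lim_{N\to\infty}\sum_{n=2}^{\infty}\frac{g_ng_{n-1}}{\lambda_n}\,|\gamma^N_n-\gamma^N_{n-1}|^2=0,$$ then the weight sequence $w_n(\lambda,g)$ is optimal.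
   Context: $\mathbb{N}=\{1,2,3,\dots\}$, $\mathbb{N}_0=\{0,1,2,\dots\}$, and $C_c(\mathbb{N}_0)$ is the space of finitely supported functions (sequences) on $\mathbb{N}_0$. The weight sequence $w=\{w_n\}$ is called optimal if, whenever $\widetilde w=\{\widetilde w_n\}_{n\ge1}$ is a real sequence with $\widetilde w_n\ge w_n$ for all $n\in\mathbb{N}$ such that $\sum_{n\ge1}\widetilde w_n|A_n|^2\le\sum_{n\ge1}|A_n-A_{n-1}|^2/\lambda_n$ holds for all $A\in C_c(\mathbb{N}_0)$ with $A_0=0$, one has $\widetilde w_n=w_n$ for all $n\in\mathbb{N}$. *)

theory Defs
  imports "HOL-Analysis.Analysis"
begin

definition finsupp_seqs :: "(nat \<Rightarrow> 'a::zero) set" where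
  "finsupp_seqs = {A. finite {n. A n \<noteq> 0}}"

(* Weights are indexed by n >= 1; the value at index 0 is never used. *)
definition hardy_weight :: "(nat \<Rightarrow> real) \<Rightarrow> (nat \<Rightarrow> real) \<Rightarrow> nat \<Rightarrow> real" where
  "hardy_weight lam g n =
     1 / lam n + 1 / lam (n + 1) - g (n - 1) / (lam n * g n) - g (n + 1) / (lam (n + 1) * g n)"

(* The type argument is the scalar field of the test sequences (real or complex).
   Both sums have only finitely many nonzero terms. *)
definition hardy_inequality ::
  "'a::real_normed_field itself \<Rightarrow> (nat \<Rightarrow> real) \<Rightarrow> (nat \<Rightarrow> real) \<Rightarrow> bool" where
  "hardy_inequality T lam w \<longleftrightarrow>
     (\<forall>A :: nat \<Rightarrow> 'a. A \<in> finsupp_seqs \<longrightarrow> A 0 = 0 \<longrightarrow>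
        (\<Sum>\<^sub>\<infinity>n\<in>{1..}. w n * (norm (A n))\<^sup>2)
          \<le> (\<Sum>\<^sub>\<infinity>n\<in>{1..}. (norm (A n - A (n - 1)))\<^sup>2 / lam n))"

definition optimal_weight ::
  "'a::real_normed_field itself \<Rightarrow> (nat \<Rightarrow> real) \<Rightarrow> (nat \<Rightarrow> real) \<Rightarrow> bool" where
  "optimal_weight T lam w \<longleftrightarrow>
     (\<forall>w' :: nat \<Rightarrow> real. (\<forall>n\<ge>1. w' n \<ge> w n) \<longrightarrow> hardy_inequality T lam w' \<longrightarrow>
        (\<forall>n\<ge>1. w' n = w n))"

end

theory Submission
  imports Defs
begin

text \<open>Writing \<open>A = g \<phi>\<close>, the energy of \<open>A\<close> minus its weighted mass is the energy
  of \<open>\<phi>\<close> with edge weights \<open>g n * g (n - 1) / lam n\<close> (ground state representation).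
  This is nonnegative, which is the Hardy inequality. For \<open>\<phi> = \<gamma>\<^sup>N\<close> it tends to zero,
  so any excess of a competing weight \<open>w'\<close> over \<open>w\<close> at a single index
  is squeezed to zero.\<close>

text \<open>Polarization: the cross term \<open>-2 * a * b * (x \<bullet> y)\<close> is traded for
  \<open>norm (x - y)\<close> via 2<x,y> = |x|^2 + |y|^2 - |x - y|^2. An edge energy thus splits
  into a share for each endpoint plus the energy of the unscaled difference.\<close>

lemma norm_scaled_diff_sq:
  fixes x y :: "'a::real_inner"
  shows "(norm (a *\<^sub>R x - b *\<^sub>R y))\<^sup>2 =
    a * (a - b) * (norm x)\<^sup>2 + b * (b - a) * (norm y)\<^sup>2 + a * b * (norm (x - y))\<^sup>2"
  unfolding power2_norm_eq_inner
  by (simp add: inner_simps inner_commute algebra_simps)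

lemma infsum_atLeast_eq_sum:
  fixes f :: "nat \<Rightarrow> real"
  assumes "\<And>n. n > M \<Longrightarrow> f n = 0"
  shows "(\<Sum>\<^sub>\<infinity>n\<in>{k..}. f n) = (\<Sum>n=k..M. f n)"
proof -
  have "(\<Sum>\<^sub>\<infinity>n\<in>{k..}. f n) = (\<Sum>\<^sub>\<infinity>n\<in>{k..M}. f n)"
    by (rule infsum_cong_neutral) (use assms in auto)
  then show ?thesis by simp
qed

lemma finsupp_seqs_bound:
  assumes "A \<in> finsupp_seqs"
  obtains M where "\<And>n. n \<ge> M \<Longrightarrow> A n = 0"
proof -
  obtain M where "\<forall>n\<in>{n. A n \<noteq> 0}. n < M"
    using assms unfolding finsupp_seqs_def by (auto simp: finite_nat_set_iff_bounded)
  then have "A n = 0" if "n \<ge> M" for n using that by (meson leD mem_Collect_eq)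
  then show ?thesis using that by blast
qed

text \<open>Each vertex collects its shares from the two adjacent edges, and these add up to
  \<open>hardy_weight\<close>. The subtracted boundary term is the share that vertex
  \<open>M\<close> takes from edge \<open>Suc M\<close>, which lies outside the sum.\<close>

lemma ground_state_partial_sum:
  fixes \<phi> :: "nat \<Rightarrow> 'a::real_inner"
  assumes g0: "g 0 = 0" and g_pos: "\<And>n. n \<ge> 1 \<Longrightarrow> g n > 0"
  shows "(\<Sum>n=1..M. (norm (g n *\<^sub>R \<phi> n - g (n - 1) *\<^sub>R \<phi> (n - 1)))\<^sup>2 / lam n)
    = (\<Sum>n=1..M. hardy_weight lam g n * (norm (g n *\<^sub>R \<phi> n))\<^sup>2)
      + (\<Sum>n=1..M. g n * g (n - 1) / lam n * (norm (\<phi> n - \<phi> (n - 1)))\<^sup>2)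
      - g M * (g M - g (Suc M)) * (norm (\<phi> M))\<^sup>2 / lam (Suc M)"
proof (induction M)
  case 0
  then show ?case by (simp add: g0)
next
  case (Suc M)
  let ?n = "Suc M"
  have cancel: "g ?n * (inverse (g ?n) * x) = x" for x using g_pos[of ?n] by simp
  \<comment> \<open>The weighted mass at \<open>?n\<close>, sorted by edge: first the share from
    edge \<open>?n\<close>, then the one from edge \<open>Suc ?n\<close>.\<close>
  have w: "hardy_weight lam g ?n * (norm (g ?n *\<^sub>R \<phi> ?n))\<^sup>2 =
    g ?n * (g ?n - g M) * (norm (\<phi> ?n))\<^sup>2 / lam ?n
    + g ?n * (g ?n - g (Suc ?n)) * (norm (\<phi> ?n))\<^sup>2 / lam (Suc ?n)"
    by (simp add: hardy_weight_def power_mult_distrib power2_eq_square[of "g ?n"]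
        divide_inverse cancel algebra_simps)
  \<comment> \<open>The third summand cancels the boundary term of the induction hypothesis; the
    last one is the new boundary term.\<close>
  have "(norm (g ?n *\<^sub>R \<phi> ?n - g M *\<^sub>R \<phi> M))\<^sup>2 / lam ?n =
    hardy_weight lam g ?n * (norm (g ?n *\<^sub>R \<phi> ?n))\<^sup>2
    + g ?n * g M / lam ?n * (norm (\<phi> ?n - \<phi> M))\<^sup>2
    + g M * (g M - g ?n) * (norm (\<phi> M))\<^sup>2 / lam ?n
    - g ?n * (g ?n - g (Suc ?n)) * (norm (\<phi> ?n))\<^sup>2 / lam (Suc ?n)"
    unfolding w norm_scaled_diff_sq by (simp add: add_divide_distrib)
  with Suc.IH show ?case by simp
qed

lemma ground_state_representation:
  fixes \<phi> :: "nat \<Rightarrow> 'a::real_inner"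
  assumes g0: "g 0 = 0" and g_pos: "\<And>n. n \<ge> 1 \<Longrightarrow> g n > 0"
    and \<phi>: "\<phi> \<in> finsupp_seqs"
  shows "(\<Sum>\<^sub>\<infinity>n\<in>{1..}. (norm (g n *\<^sub>R \<phi> n - g (n - 1) *\<^sub>R \<phi> (n - 1)))\<^sup>2 / lam n)
    = (\<Sum>\<^sub>\<infinity>n\<in>{1..}. hardy_weight lam g n * (norm (g n *\<^sub>R \<phi> n))\<^sup>2)
      + (\<Sum>\<^sub>\<infinity>n\<in>{2..}. g n * g (n - 1) / lam n * (norm (\<phi> n - \<phi> (n - 1)))\<^sup>2)"
proof -
  \<comment> \<open>Vanishing already at \<open>M\<close> itself removes the boundary term, and also
    the difference terms at \<open>n = M + 1\<close> and beyond.\<close>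
  obtain M where M: "\<And>n. n \<ge> M \<Longrightarrow> \<phi> n = 0"
    using finsupp_seqs_bound[OF \<phi>] by blast
  \<comment> \<open>The edge \<open>n = 1\<close> carries the factor \<open>g 0 = 0\<close>, so the
    sum may start at 2.\<close>
  have "(\<Sum>n=1..M. g n * g (n - 1) / lam n * (norm (\<phi> n - \<phi> (n - 1)))\<^sup>2)
    = (\<Sum>n=2..M. g n * g (n - 1) / lam n * (norm (\<phi> n - \<phi> (n - 1)))\<^sup>2)"
  proof (rule sum.mono_neutral_right)
    show "\<forall>n\<in>{1..M} - {2..M}. g n * g (n - 1) / lam n * (norm (\<phi> n - \<phi> (n - 1)))\<^sup>2 = 0"
    proof
      fix n assume "n \<in> {1..M} - {2..M}"
      then have "n = 1" by auto
      then show "g n * g (n - 1) / lam n * (norm (\<phi> n - \<phi> (n - 1)))\<^sup>2 = 0"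
        by (simp add: g0)
    qed
  qed auto
  then show ?thesis
    using ground_state_partial_sum[of g \<phi> lam M] g0 g_pos M
    by (simp add: infsum_atLeast_eq_sum[of M])
qed

text \<open>The remainder in the ground state representation is nonnegative. The sort of
  \<open>'a\<close> lets one argument serve both real and complex scalars.\<close>

lemma hardy_inequality_hardy_weight:
  assumes g0: "g 0 = 0" and g_pos: "\<And>n. n \<ge> 1 \<Longrightarrow> g n > 0"
    and lam_pos: "\<And>n. n \<ge> 1 \<Longrightarrow> lam n > 0"
  shows "hardy_inequality TYPE('a::{real_normed_field,real_inner}) lam (hardy_weight lam g)"
  unfolding hardy_inequality_def
proof (intro allI impI)
  fix A :: "nat \<Rightarrow> 'a"
  assume A: "A \<in> finsupp_seqs" and A0: "A 0 = 0"
  \<comment> \<open>At 0 the inverse of \<open>g 0 = 0\<close> is 0 by convention;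
    \<open>A 0 = 0\<close> still gives \<open>g n *\<^sub>R \<phi> n = A n\<close> there.\<close>
  define \<phi> where "\<phi> n = inverse (g n) *\<^sub>R A n" for n
  have "{n. \<phi> n \<noteq> 0} \<subseteq> {n. A n \<noteq> 0}" by (auto simp: \<phi>_def)
  then have \<phi>: "\<phi> \<in> finsupp_seqs"
    using A unfolding finsupp_seqs_def by (auto intro: finite_subset)
  have g\<phi>: "g n *\<^sub>R \<phi> n = A n" for n
    using g_pos[of n] A0 by (cases "n = 0") (auto simp: \<phi>_def)
  have "0 \<le> (\<Sum>\<^sub>\<infinity>n\<in>{2..}. g n * g (n - 1) / lam n * (norm (\<phi> n - \<phi> (n - 1)))\<^sup>2)"
  proof (rule infsum_nonneg)
    fix n :: nat assume "n \<in> {2..}"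
    then show "0 \<le> g n * g (n - 1) / lam n * (norm (\<phi> n - \<phi> (n - 1)))\<^sup>2"
      using g_pos[of n] g_pos[of "n - 1"] lam_pos[of n]
      by (intro mult_nonneg_nonneg divide_nonneg_nonneg) (auto intro: less_imp_le)
  qed
  then show "(\<Sum>\<^sub>\<infinity>n\<in>{1..}. hardy_weight lam g n * (norm (A n))\<^sup>2)
      \<le> (\<Sum>\<^sub>\<infinity>n\<in>{1..}. (norm (A n - A (n - 1)))\<^sup>2 / lam n)"
    using ground_state_representation[of g \<phi> lam, OF g0 g_pos \<phi>] by (simp only: g\<phi>)
qed

text \<open>Testing the inequality for \<open>w'\<close> with g\<gamma> and subtracting the
  representation leaves the total excess of \<open>w'\<close> bounded by the edge energy. All excess
  terms are nonnegative, so each one obeys the same bound.\<close>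

lemma weight_excess_le_energy:
  fixes \<gamma> :: "nat \<Rightarrow> real"
  assumes g0: "g 0 = 0" and g_pos: "\<And>n. n \<ge> 1 \<Longrightarrow> g n > 0"
    and \<gamma>: "\<gamma> \<in> finsupp_seqs"
    and w': "\<And>n. n \<ge> 1 \<Longrightarrow> w' n \<ge> hardy_weight lam g n"
    and hardy: "hardy_inequality TYPE('a::{real_normed_field,real_inner}) lam w'"
    and k: "k \<ge> 1"
  shows "(w' k - hardy_weight lam g k) * (g k * \<gamma> k)\<^sup>2
    \<le> (\<Sum>\<^sub>\<infinity>n\<in>{2..}. g n * g (n - 1) / lam n * \<bar>\<gamma> n - \<gamma> (n - 1)\<bar>\<^sup>2)" (is "_ \<le> ?E")
proof -
  define w where "w = hardy_weight lam g"
  define \<phi> :: "nat \<Rightarrow> 'a" where "\<phi> n = of_real (\<gamma> n)" for n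
  define A where "A n = g n *\<^sub>R \<phi> n" for n
  have \<phi>: "\<phi> \<in> finsupp_seqs" using \<gamma> by (simp add: finsupp_seqs_def \<phi>_def)
  have "{n. A n \<noteq> 0} \<subseteq> {n. \<phi> n \<noteq> 0}" by (auto simp: A_def)
  then have A: "A \<in> finsupp_seqs"
    using \<phi> unfolding finsupp_seqs_def by (auto intro: finite_subset)
  have A0: "A 0 = 0" by (simp add: A_def g0)
  obtain M where M: "\<And>n. n \<ge> M \<Longrightarrow> A n = 0"
    using finsupp_seqs_bound[OF A] by blast
  have normA: "(norm (A n))\<^sup>2 = (g n * \<gamma> n)\<^sup>2" for n
    by (simp add: A_def \<phi>_def power_mult_distrib)
  have norm\<phi>: "norm (\<phi> n - \<phi> (n - 1)) = \<bar>\<gamma> n - \<gamma> (n - 1)\<bar>" for n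
    unfolding \<phi>_def of_real_diff[symmetric] by (rule norm_of_real)
  have "(\<Sum>\<^sub>\<infinity>n\<in>{1..}. w' n * (norm (A n))\<^sup>2)
      \<le> (\<Sum>\<^sub>\<infinity>n\<in>{1..}. (norm (A n - A (n - 1)))\<^sup>2 / lam n)"
    using hardy A A0 unfolding hardy_inequality_def by blast
  also have "\<dots> = (\<Sum>\<^sub>\<infinity>n\<in>{1..}. w n * (norm (A n))\<^sup>2) + ?E"
    using ground_state_representation[of g \<phi> lam, OF g0 g_pos \<phi>]
    by (simp only: norm\<phi> A_def w_def)
  finally have "(\<Sum>n=1..M. (w' n - w n) * (norm (A n))\<^sup>2) \<le> ?E"
    using M by (simp add: infsum_atLeast_eq_sum[of M] left_diff_distrib sum_subtractf)
  \<comment> \<open>For \<open>k > M\<close> the index is outside the sum, but then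
    \<open>A k = 0\<close> and the left side vanishes.\<close>
  moreover have "(w' k - w k) * (norm (A k))\<^sup>2 \<le> (\<Sum>n=1..M. (w' n - w n) * (norm (A n))\<^sup>2)"
  proof (cases "k \<le> M")
    case True
    with k w' show ?thesis by (intro member_le_sum) (auto simp: w_def)
  next
    case False
    with M w' show ?thesis by (auto intro!: sum_nonneg simp: w_def)
  qed
  ultimately show ?thesis by (simp add: normA w_def)
qed

lemma optimal_weight_hardy_weight:
  fixes \<gamma> :: "nat \<Rightarrow> nat \<Rightarrow> real"
  assumes g0: "g 0 = 0" and g_pos: "\<And>n. n \<ge> 1 \<Longrightarrow> g n > 0"
    and fin: "\<And>N. N \<ge> 1 \<Longrightarrow> \<gamma> N \<in> finsupp_seqs"
    and lim: "\<And>n. (\<lambda>N. \<gamma> N n) \<longlonglongrightarrow> 1"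
    and energy: "(\<lambda>N. \<Sum>\<^sub>\<infinity>n\<in>{2..}. g n * g (n - 1) / lam n * \<bar>\<gamma> N n - \<gamma> N (n - 1)\<bar>\<^sup>2)
      \<longlonglongrightarrow> 0"
  shows "optimal_weight TYPE('a::{real_normed_field,real_inner}) lam (hardy_weight lam g)"
  unfolding optimal_weight_def
proof (intro allI impI)
  fix w' :: "nat \<Rightarrow> real" and k :: nat
  assume w': "\<forall>n\<ge>1. w' n \<ge> hardy_weight lam g n"
    and hardy: "hardy_inequality TYPE('a) lam w'" and k: "k \<ge> 1"
  let ?d = "w' k - hardy_weight lam g k"
  have "(\<lambda>N. ?d * (g k * \<gamma> N k)\<^sup>2) \<longlonglongrightarrow> ?d * (g k * 1)\<^sup>2"
    by (intro tendsto_intros lim)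
  then have "?d * (g k * 1)\<^sup>2 \<le> 0"
  \<comment> \<open>The sequences are compared from \<open>N = 1\<close> on, where
    \<open>fin\<close> gives finite support.\<close>
  proof (rule LIMSEQ_le[OF _ energy], intro exI allI impI)
    fix N :: nat assume "N \<ge> 1"
    then show "?d * (g k * \<gamma> N k)\<^sup>2
        \<le> (\<Sum>\<^sub>\<infinity>n\<in>{2..}. g n * g (n - 1) / lam n * \<bar>\<gamma> N n - \<gamma> N (n - 1)\<bar>\<^sup>2)"
      using weight_excess_le_energy[of g "\<gamma> N", OF g0 g_pos fin _ hardy k] w' by blast
  qed
  \<comment> \<open>The limit of the squared factor is \<open>(g k)\<^sup>2 > 0\<close>, so the sign
    of the product is that of \<open>?d\<close>.\<close>
  then have "?d \<le> 0"
    using g_pos[OF k] by (simp add: mult_le_0_iff)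
  with w' k show "w' k = hardy_weight lam g k" by (simp add: order_antisym)
qed

theorem theorem2p1:
  fixes g lam :: "nat \<Rightarrow> real"
  assumes g0: "g 0 = 0"
    and g_pos: "\<And>n. n \<ge> 1 \<Longrightarrow> g n > 0"
    and lam_pos: "\<And>n. n \<ge> 1 \<Longrightarrow> lam n > 0"
  shows "hardy_inequality TYPE(real) lam (hardy_weight lam g)
    \<and> hardy_inequality TYPE(complex) lam (hardy_weight lam g)
    \<and> ((\<exists>\<gamma> :: nat \<Rightarrow> nat \<Rightarrow> real.
          (\<forall>N\<ge>1. \<gamma> N \<in> finsupp_seqs)
        \<and> (\<forall>N\<ge>1. \<forall>n. \<gamma> N n \<le> \<gamma> (N + 1) n)
        \<and> (\<forall>n. (\<lambda>N. \<gamma> N n) \<longlonglongrightarrow> 1)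
        \<and> (\<lambda>N. \<Sum>\<^sub>\<infinity>n\<in>{2..}. g n * g (n - 1) / lam n * \<bar>\<gamma> N n - \<gamma> N (n - 1)\<bar>\<^sup>2) \<longlonglongrightarrow> 0)
      \<longrightarrow> optimal_weight TYPE(real) lam (hardy_weight lam g)
        \<and> optimal_weight TYPE(complex) lam (hardy_weight lam g))"
proof (intro conjI impI)
  show "hardy_inequality TYPE(real) lam (hardy_weight lam g)"
    and "hardy_inequality TYPE(complex) lam (hardy_weight lam g)"
    by (rule hardy_inequality_hardy_weight[of g, OF g0 g_pos lam_pos]; assumption)+
qed (blast intro: optimal_weight_hardy_weight[of g, OF g0 g_pos])+

end
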